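(* Let $d\geq 2$. Then there exists a monotone increasing function $\beta_{d}\colon [1,\infty)\to [1,\infty)$ such that $2\lfloor t\rfloor-1\leq\beta_{d}(t)\leq 2^{8dt}$ for all $t\in [1,\infty)$ and the following holds: Let $T,N\in \mathbb{N}$, $m\in\mathbb{R}$ and let $\sigma\colon \frac{1}{N}\mathbb{Z}^{d-1}\to \frac{1}{N}\mathbb{Z}^{d-1}$ be a permutation with $\|\sigma(x)-x\|\leq T$ for all $x\in \frac{1}{N}\mathbb{Z}^{d-1}$. Then there exists an $N\beta_{d}(6NT)^{3^{d-1}}$-bilipschitz mapping \[\Upsilon\colon\mathbb{R}^{d-1}\times[m-\tfrac{1}{2},m+\tfrac{1}{2}]\to \mathbb{R}^{d-1}\times [m-\tfrac{1}{2},m+\tfrac{1}{2}]\] such that (i) $\Upsilon(x)=x$ for all $x\in\mathbb{R}^{d-1}\times \{m-\frac{1}{2},m+\frac{1}{2}\}$, and (ii) $\Upsilon(x,m)=(\sigma(x),m)$ for all $x\in \frac{1}{N}\mathbb{Z}^{d-1}$. Moreover, $\beta_d$ may be taken to be the function $\beta_d$ defined in the context below.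
   Context: $\|\cdot\|$ is the Euclidean norm. A mapping is $L$-bilipschitz if it is injective and both it and its inverse are $L$-Lipschitz. Definition of $\beta_d$: let $\mathcal{F}_d$ be the collection of all monotone increasing functions $\psi\colon[1,\infty)\to[1,\infty)$ such that the following holds: for every $S\in\mathbb{N}$, with $Q:=(-\frac12,\dots,-\frac12)+[0,S]^{d-1}\subseteq\mathbb{R}^{d-1}$, and every permutation $\sigma\colon\mathbb{Z}^{d-1}\to\mathbb{Z}^{d-1}$ such that for each $z\in\mathbb{Z}^{d-1}$ the restriction of $\sigma$ to $\mathbb{Z}^{d-1}\cap(Q+Sz)$ is a permutation of $\mathbb{Z}^{d-1}\cap(Q+Sz)$, there is a $\psi(S)$-bilipschitz mapping $\Upsilon\colon\mathbb{R}^d\to\mathbb{R}^d$ with $\Upsilon(x)=x$ for all $x\in\mathbb{R}^{d-1}\times(\mathbb{R}\setminus(-\frac12,\frac12))$ and $\Upsilon(x,0)=(\sigma(x),0)$ for all $x\in\mathbb{Z}^{d-1}$. Then $\beta_d$ is the pointwise infimum of $\mathcal{F}_d$. *)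

theory Defs
  imports "HOL-Analysis.Analysis"
begin

text \<open>R^(d-1) is modelled as real^'n (so d - 1 = CARD('n) >= 1, i.e. d >= 2),
  and R^d as (real^'n) \<times> real, whose norm is the Euclidean norm.\<close>

definition bilipschitz_on :: "real \<Rightarrow> 'a::metric_space set \<Rightarrow> ('a \<Rightarrow> 'b::metric_space) \<Rightarrow> bool" where
  "bilipschitz_on L S f \<longleftrightarrow>
     inj_on f S \<and> L-lipschitz_on S f \<and> L-lipschitz_on (f ` S) (inv_into S f)"

definition scaled_lattice :: "nat \<Rightarrow> (real^'n) set" where
  "scaled_lattice N = {x. \<forall>i. real N * x $ i \<in> \<int>}"

definition cube_block :: "nat \<Rightarrow> real^'n \<Rightarrow> (real^'n) set" where
  "cube_block S z = {y. \<forall>i. - 1/2 + real S * z $ i \<le> y $ i \<and> y $ i \<le> - 1/2 + real S * z $ i + real S}"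

definition admissible_funs :: "'n::finite itself \<Rightarrow> (real \<Rightarrow> real) set" where
  "admissible_funs _ = {\<psi>. mono_on {1..} \<psi> \<and> \<psi> ` {1..} \<subseteq> {1..} \<and>
     (\<forall>(S::nat) (\<sigma>::real^'n \<Rightarrow> real^'n). S \<ge> 1 \<longrightarrow>
        bij_betw \<sigma> (scaled_lattice 1) (scaled_lattice 1) \<longrightarrow>
        (\<forall>z\<in>scaled_lattice 1.
           bij_betw \<sigma> (scaled_lattice 1 \<inter> cube_block S z) (scaled_lattice 1 \<inter> cube_block S z)) \<longrightarrow>
        (\<exists>\<Upsilon>::(real^'n) \<times> real \<Rightarrow> (real^'n) \<times> real.
           bilipschitz_on (\<psi> (real S)) UNIV \<Upsilon> \<and>
           (\<forall>x t. \<bar>t\<bar> \<ge> 1/2 \<longrightarrow> \<Upsilon> (x, t) = (x, t)) \<and>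
           (\<forall>x\<in>scaled_lattice 1. \<Upsilon> (x, 0) = (\<sigma> x, 0))))}"

definition beta :: "'n::finite itself \<Rightarrow> real \<Rightarrow> real" where
  "beta n t = (INF \<psi>\<in>admissible_funs n. \<psi> t)"

end

theory Submission
  imports Defs
begin

text \<open>A lattice permutation \<open>\<sigma>\<close> with only \<open>K\<close> different displacements \<open>\<sigma> z - z\<close> is
  realized as follows. Assign to each displacement its own height in \<open>(- 1/2, 1/2)\<close>. Lift
  every lattice point \<open>z\<close> to the height of \<open>\<sigma> z - z\<close>, shear by \<open>(x, t) \<mapsto> (x + s t, t)\<close> where
  \<open>s\<close> takes the value \<open>v\<close> at the height of \<open>v\<close>, and lower the points back to height 0. The
  constants are polynomial in \<open>K\<close>. For permutations of blocks of side \<open>S\<close> this stays far below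
  \<open>2\<^sup>8\<^sup>d\<^sup>S\<close>, which yields the upper bound on \<open>\<beta>\<close>. For permutations of displacement at most
  \<open>T\<close> it stays below the required power of \<open>\<beta>\<close>, because of the lower bound on \<open>\<beta>\<close>: if
  each block is reversed, the adjacent points \<open>-1\<close> and \<open>0\<close> are moved apart to distance
  \<open>2 S - 1\<close> (in every coordinate).

  No decomposition of \<open>\<sigma>\<close> into block permutations is used; none exists in general, for instance for
  the translation \<open>z \<mapsto> z + 1\<close> of \<open>\<int>\<close>.\<close>

section \<open>Bilipschitz maps and distances in products\<close>

lemma bilipschitz_onI:
  assumes "0 \<le> L"
    and upper: "\<And>x y. x \<in> S \<Longrightarrow> y \<in> S \<Longrightarrow> dist (f x) (f y) \<le> L * dist x y"
    and lower: "\<And>x y. x \<in> S \<Longrightarrow> y \<in> S \<Longrightarrow> dist x y \<le> L * dist (f x) (f y)"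
  shows "bilipschitz_on L S f"
proof -
  have inj: "inj_on f S"
    by (rule inj_onI) (use lower in force)
  moreover have "L-lipschitz_on S f"
    using assms by (intro lipschitz_onI) auto
  moreover have "L-lipschitz_on (f ` S) (inv_into S f)"
    using inj assms by (intro lipschitz_onI) auto
  ultimately show ?thesis
    by (simp add: bilipschitz_on_def)
qed

lemma bilipschitz_onD:
  assumes "bilipschitz_on L S f" "x \<in> S" "y \<in> S"
  shows "dist (f x) (f y) \<le> L * dist x y" and "dist x y \<le> L * dist (f x) (f y)"
proof -
  show "dist (f x) (f y) \<le> L * dist x y"
    using assms lipschitz_onD unfolding bilipschitz_on_def by metis
  have "dist (inv_into S f (f x)) (inv_into S f (f y)) \<le> L * dist (f x) (f y)"
    using assms by (intro lipschitz_onD[of L "f ` S"]) (auto simp: bilipschitz_on_def)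
  then show "dist x y \<le> L * dist (f x) (f y)"
    using assms by (simp add: bilipschitz_on_def)
qed

lemma bilipschitz_on_mono:
  assumes "bilipschitz_on L S f" "L \<le> L'"
  shows "bilipschitz_on L' S f"
  using assms(1) by (auto simp: bilipschitz_on_def intro: lipschitz_on_le[OF _ assms(2)])

lemma dist_Pair_le_add:
  fixes p q :: "'a::metric_space \<times> 'b::metric_space"
  shows "dist p q \<le> dist (fst p) (fst q) + dist (snd p) (snd q)"
  by (simp add: dist_prod_def sqrt_sum_squares_le_sum)

text \<open>\<open>3/2\<close> is a rational substitute for the optimal constant
  \<open>sqrt 2\<close>; twice it is the factor 3 in the distortion bounds for lifts.\<close>

lemma add_le_dist_Pair:
  fixes p q :: "'a::metric_space \<times> 'b::metric_space"
  shows "dist (fst p) (fst q) + dist (snd p) (snd q) \<le> 3/2 * dist p q"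
proof -
  define a b where "a = dist (fst p) (fst q)" and "b = dist (snd p) (snd q)"
  have "(a + b)\<^sup>2 \<le> (3/2)\<^sup>2 * (a\<^sup>2 + b\<^sup>2)"
  proof -
    have "(3/2)\<^sup>2 * (a\<^sup>2 + b\<^sup>2) = (a + b)\<^sup>2 + ((a - b)\<^sup>2 + (a\<^sup>2 + b\<^sup>2) / 4)"
      by (simp add: power2_eq_square field_simps)
    then show ?thesis
      by simp
  qed
  then have "a + b \<le> sqrt ((3/2)\<^sup>2 * (a\<^sup>2 + b\<^sup>2))"
    by (rule real_le_rsqrt)
  also have "\<dots> = 3/2 * sqrt (a\<^sup>2 + b\<^sup>2)"
    by (simp add: real_sqrt_mult)
  finally show ?thesis
    by (simp add: a_def b_def dist_prod_def)
qed

section \<open>Lipschitz interpolation of values on a separated set\<close>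

text \<open>The open balls of radius \<open>D / 2\<close> about the points of \<open>Z\<close> are
  disjoint, so cones of height \<open>v z\<close> supported on them interpolate \<open>v\<close>.
  Each cone has slope at most \<open>2 * R / D\<close>, and passing from one cone to another costs
  no further factor. The vanishing off the balls later makes the shear stop at the boundary
  heights.\<close>

lemma separated_interpolation:
  fixes v :: "'a::metric_space \<Rightarrow> 'b::real_normed_vector"
  assumes D: "D > 0" and R: "R \<ge> 0"
    and sep: "\<And>x y. x \<in> Z \<Longrightarrow> y \<in> Z \<Longrightarrow> x \<noteq> y \<Longrightarrow> D \<le> dist x y"
    and bound: "\<And>z. z \<in> Z \<Longrightarrow> norm (v z) \<le> R"
  obtains s where "(2 * R / D)-lipschitz_on UNIV s" "\<And>z. z \<in> Z \<Longrightarrow> s z = v z"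
    "\<And>x. norm (s x) \<le> R" "\<And>x. (\<And>z. z \<in> Z \<Longrightarrow> D / 2 \<le> dist x z) \<Longrightarrow> s x = 0"
proof -
  define near where "near x \<longleftrightarrow> (\<exists>z\<in>Z. dist x z < D / 2)" for x
  have "\<exists>c. \<forall>x. near x \<longrightarrow> c x \<in> Z \<and> dist x (c x) < D / 2"
    by (intro choice) (auto simp: near_def)
  then obtain c where c: "\<And>x. near x \<Longrightarrow> c x \<in> Z" "\<And>x. near x \<Longrightarrow> dist x (c x) < D / 2"
    by blast
  define w where "w x z = (D - 2 * dist x z) / D" for x z :: 'a
  define s where "s x = (if near x then w x (c x) *\<^sub>R v (c x) else 0)" for x
  have w01: "0 \<le> w x (c x)" "w x (c x) \<le> 1" if "near x" for x
    using c(2)[OF that] D by (auto simp: w_def field_simps)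
  have s_le: "norm (s x) \<le> w x (c x) * R" if "near x" for x
    using w01[OF that] bound[OF c(1)[OF that]] that by (simp add: s_def mult_left_mono)
  \<comment> \<open>Only \<open>x\<close> is assumed to lie in a ball; symmetry of the distance
    covers the reverse situation, and if neither point does, both values are 0.\<close>
  have one_sided: "dist (s x) (s y) \<le> 2 * R / D * dist x y" if "near x" for x y
  proof (cases "near y")
    case False
    \<comment> \<open>As \<open>y\<close> is outside the ball about \<open>c x\<close>, the triangle
      inequality bounds the weight at \<open>x\<close> by the slope times
      \<open>dist x y\<close>.\<close>
    then have "D / 2 \<le> dist y (c x)"
      using c(1)[OF that] by (force simp: near_def)
    also have "\<dots> \<le> dist x y + dist x (c x)"
      by (metis dist_commute dist_triangle)
    finally have "w x (c x) \<le> 2 * dist x y / D"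
      unfolding w_def using D by (intro divide_right_mono) auto
    then have "w x (c x) * R \<le> 2 * dist x y / D * R"
      using R by (rule mult_right_mono)
    then show ?thesis
      using s_le[OF that] False by (simp add: s_def[of y] mult_ac)
  next
    case y: True
    show ?thesis
    proof (cases "c x = c y")
      case True
      have "\<bar>w x (c y) - w y (c y)\<bar> = 2 / D * \<bar>dist y (c y) - dist x (c y)\<bar>"
        using D by (simp add: w_def abs_if field_simps)
      also have "\<dots> \<le> 2 / D * dist x y"
        using D abs_dist_diff_le[of y "c y" x] by (intro mult_left_mono) (auto simp: dist_commute)
      finally have "\<bar>w x (c y) - w y (c y)\<bar> * norm (v (c y)) \<le> 2 / D * dist x y * R"
        using bound[OF c(1)[OF y]] D by (intro mult_mono) auto
      moreover have "dist (s x) (s y) = \<bar>w x (c y) - w y (c y)\<bar> * norm (v (c y))"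
        using that y True by (simp add: s_def dist_norm flip: scaleR_left_diff_distrib)
      ultimately show ?thesis
        by (simp add: mult_ac)
    next
      case False
      \<comment> \<open>Separation of the centres bounds the sum of the two weights, not only each
        of them, by \<open>2 * dist x y / D\<close>. This prevents a doubling of the Lipschitz
        constant.\<close>
      then have "D \<le> dist (c x) (c y)"
        using sep c(1) that y by blast
      also have "\<dots> \<le> dist x (c x) + dist x y + dist y (c y)"
        by (metis add.commute add_left_mono dist_commute dist_triangle dist_triangle_le)
      finally have "w x (c x) + w y (c y) \<le> 2 * dist x y / D"
        unfolding w_def add_divide_distrib[symmetric] using D by (intro divide_right_mono) auto
      then have "(w x (c x) + w y (c y)) * R \<le> 2 * dist x y / D * R"
        using R by (rule mult_right_mono)
      moreover have "dist (s x) (s y) \<le> norm (s x) + norm (s y)"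
        by (simp add: dist_norm norm_triangle_ineq4)
      ultimately show ?thesis
        using s_le[OF that] s_le[OF y] by (simp add: algebra_simps)
    qed
  qed
  show thesis
  proof
    show "(2 * R / D)-lipschitz_on UNIV s"
    proof (rule lipschitz_onI)
      show "dist (s x) (s y) \<le> 2 * R / D * dist x y" for x y
      proof (cases "near x \<or> near y")
        case True
        then show ?thesis
          using one_sided[of x y] one_sided[of y x] by (auto simp: dist_commute)
      qed (use R D in \<open>simp add: s_def\<close>)
    qed (use R D in simp)
    show "s z = v z" if "z \<in> Z" for z
    proof -
      have "near z"
        using that D by (force simp: near_def)
      \<comment> \<open>Another centre within \<open>D / 2\<close> of \<open>z\<close> would violate
        separation.\<close>
      moreover have "c z = z"
        using sep[OF that c(1)] c[of z] \<open>near z\<close> D by fastforce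
      ultimately show ?thesis
        using D by (simp add: s_def w_def)
    qed
    show "norm (s x) \<le> R" for x
      using s_le[of x] w01[of x] R mult_right_mono[of "w x (c x)" 1 R]
      by (cases "near x") (auto simp: s_def)
    show "s x = 0" if "\<And>z. z \<in> Z \<Longrightarrow> D / 2 \<le> dist x z" for x
      using that by (force simp: s_def near_def)
  qed
qed

section \<open>Lifting points along vertical fibres\<close>

text \<open>On each fibre this is piecewise linear with nodes \<open>- 1/2\<close>, 0 and
  \<open>1/2\<close>; it moves height 0 to \<open>a x\<close> and fixes all heights of absolute
  value at least \<open>1/2\<close>. It is increasing when
  \<open>\<bar>a x\<bar> < 1/2\<close>.\<close>

definition lift :: "('a::metric_space \<Rightarrow> real) \<Rightarrow> 'a \<times> real \<Rightarrow> 'a \<times> real" where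
  "lift a p = (fst p, snd p + a (fst p) * max 0 (1 - 2 * \<bar>snd p\<bar>))"

lemma tent_Lipschitz: "\<bar>max 0 (1 - 2 * \<bar>t\<bar>) - max 0 (1 - 2 * \<bar>u\<bar>)\<bar> \<le> 2 * \<bar>t - u\<bar>" for t u :: real
  by (smt (verit))

text \<open>The tent has slope at most 2, so on one fibre the bound on \<open>a\<close> keeps the
  perturbation of slope at most \<open>1 - 1 / K\<close>: stretching is at most 2 and compression at
  worst \<open>1 / K\<close>. Changing the fibre at a fixed height costs at most \<open>M\<close>
  times the horizontal distance. \<open>K\<close> enters only through the compression, hence only in
  the second estimate.\<close>

lemma lift_bilipschitz:
  fixes a :: "'a::metric_space \<Rightarrow> real"
  assumes K: "K \<ge> 1" and M: "M \<ge> 1" and a: "M-lipschitz_on UNIV a"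
    and bound: "\<And>x. \<bar>a x\<bar> \<le> 1/2 - 1 / (2 * K)"
  shows "dist (lift a p) (lift a q) \<le> 3 * M * dist p q"
    and "dist p q \<le> 3 * K * M * dist (lift a p) (lift a q)"
proof -
  obtain x t y u where p: "p = (x, t)" and q: "q = (y, u)"
    by (metis surj_pair)
  define g where "g b r = r + b * max 0 (1 - 2 * \<bar>r\<bar>)" for b r :: real
  have lift: "lift a p = (x, g (a x) t)" "lift a q = (y, g (a y) u)"
    by (simp_all add: lift_def p q g_def)
  have a_le: "\<bar>a x - a y\<bar> \<le> M * dist x y"
    using lipschitz_onD[OF a, of x y] by (simp add: dist_real_def)
  have "\<bar>g (a x) u - g (a y) u\<bar> = \<bar>a x - a y\<bar> * max 0 (1 - 2 * \<bar>u\<bar>)"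
    by (simp add: g_def abs_mult flip: left_diff_distrib)
  also have "\<dots> \<le> \<bar>a x - a y\<bar> * 1"
    by (intro mult_left_mono) auto
  finally have horiz: "\<bar>g (a x) u - g (a y) u\<bar> \<le> M * dist x y"
    using a_le by simp
  define E where "E = a x * (max 0 (1 - 2 * \<bar>t\<bar>) - max 0 (1 - 2 * \<bar>u\<bar>))"
  have err: "\<bar>E\<bar> \<le> (1 - 1 / K) * \<bar>t - u\<bar>"
  proof -
    have "\<bar>a x\<bar> * \<bar>max 0 (1 - 2 * \<bar>t\<bar>) - max 0 (1 - 2 * \<bar>u\<bar>)\<bar> \<le> (1/2 - 1 / (2 * K)) * (2 * \<bar>t - u\<bar>)"
      using bound[of x] by (intro mult_mono tent_Lipschitz) auto
    also have "\<dots> = (1 - 1 / K) * \<bar>t - u\<bar>"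
      using K by (simp add: field_simps)
    finally show ?thesis
      by (simp add: E_def abs_mult)
  qed
  have vert: "g (a x) t - g (a x) u = (t - u) + E"
    by (simp add: g_def E_def algebra_simps)
  have err': "\<bar>E\<bar> \<le> \<bar>t - u\<bar> - \<bar>t - u\<bar> / K"
    using err by (simp add: algebra_simps)
  moreover have "0 \<le> \<bar>t - u\<bar> / K"
    using K by simp
  ultimately have vert_up: "\<bar>g (a x) t - g (a x) u\<bar> \<le> 2 * \<bar>t - u\<bar>"
    using abs_triangle_ineq[of "t - u" E] unfolding vert by (smt (verit))
  have "\<bar>t - u\<bar> / K \<le> \<bar>g (a x) t - g (a x) u\<bar>"
    using err' abs_triangle_ineq2[of "t - u" "- E"] unfolding vert by simp
  then have vert_low: "\<bar>t - u\<bar> \<le> K * \<bar>g (a x) t - g (a x) u\<bar>"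
    using K by (simp add: field_simps)
  \<comment> \<open>Both estimates pass through the height \<open>g (a x) u\<close> of the lifted
    point \<open>(x, u)\<close>: first a move along the fibre over \<open>x\<close>, then a change
    of fibre at the original height \<open>u\<close>.\<close>
  let ?d = "dist x y" and ?g = "\<bar>g (a x) t - g (a y) u\<bar>"
  have Md: "1 * ?d \<le> M * ?d" "1 * \<bar>t - u\<bar> \<le> M * \<bar>t - u\<bar>"
    by (intro mult_right_mono M; simp)+
  have "dist (lift a p) (lift a q) \<le> ?d + ?g"
    using dist_Pair_le_add[of "lift a p" "lift a q"] by (simp add: lift dist_real_def)
  also have "\<dots> \<le> M * ?d + (2 * (M * \<bar>t - u\<bar>) + M * ?d)"
    using horiz vert_up Md abs_triangle_ineq[of "g (a x) t - g (a x) u" "g (a x) u - g (a y) u"]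
    by (intro add_mono) auto
  also have "\<dots> = 2 * M * (?d + \<bar>t - u\<bar>)"
    by (simp add: algebra_simps)
  also have "\<dots> \<le> 2 * M * (3/2 * dist p q)"
    using M add_le_dist_Pair[of p q] by (intro mult_left_mono) (auto simp: p q dist_real_def)
  finally show "dist (lift a p) (lift a q) \<le> 3 * M * dist p q"
    by simp
  have KM: "1 * 1 \<le> K * M" "K * 1 \<le> K * M"
    using K M by (intro mult_mono; simp)+
  have "K * \<bar>g (a x) t - g (a x) u\<bar> \<le> K * (?g + M * ?d)"
    using horiz K by (intro mult_left_mono) linarith+
  then have "\<bar>t - u\<bar> \<le> K * ?g + K * M * ?d"
    using vert_low by (simp add: algebra_simps)
  moreover have "1 * ?d \<le> K * M * ?d" "K * ?g \<le> K * M * ?g" "0 \<le> K * M * ?g"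
    using mult_right_mono[OF KM(1), of ?d] mult_right_mono[OF KM(2), of ?g] K M by simp_all
  ultimately have "?d + \<bar>t - u\<bar> \<le> 2 * (K * M) * (?d + ?g)"
    by (simp add: algebra_simps)
  also have "\<dots> \<le> 2 * (K * M) * (3/2 * dist (lift a p) (lift a q))"
    using KM add_le_dist_Pair[of "lift a p" "lift a q"]
    by (intro mult_left_mono) (auto simp: lift dist_real_def)
  finally show "dist p q \<le> 3 * K * M * dist (lift a p) (lift a q)"
    using dist_Pair_le_add[of p q] by (simp add: p q dist_real_def mult_ac)
qed

text \<open>Makes the inverse of a lift available on the whole product. The fibre map is solved
  explicitly: its slope is \<open>1 - 2 * a x\<close> on \<open>[0, 1/2]\<close> and
  \<open>1 + 2 * a x\<close> on \<open>[- 1/2, 0]\<close>, and the sign of \<open>u - a x\<close>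
  decides which piece applies.\<close>

lemma surj_lift:
  fixes a :: "'a::metric_space \<Rightarrow> real"
  assumes "\<And>x. \<bar>a x\<bar> < 1/2"
  shows "surj (lift a)"
proof -
  have "\<exists>p. lift a p = (x, u)" for x u
  proof -
    have ax: "1 - 2 * a x > 0" "1 + 2 * a x > 0"
      using assms[of x] by linarith+
    consider "\<bar>u\<bar> \<ge> 1/2" | "\<bar>u\<bar> < 1/2" "u \<ge> a x" | "\<bar>u\<bar> < 1/2" "u < a x"
      by linarith
    then show ?thesis
    proof cases
      case 1
      then have "lift a (x, u) = (x, u)"
        by (simp add: lift_def)
      then show ?thesis ..
    next
      case 2
      define t where "t = (u - a x) / (1 - 2 * a x)"
      have "0 \<le> t" "t \<le> 1/2"
        using 2 ax by (auto simp: t_def field_simps)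
      moreover have "t * (1 - 2 * a x) = u - a x"
        using ax by (simp add: t_def)
      ultimately have "lift a (x, t) = (x, u)"
        by (simp add: lift_def algebra_simps)
      then show ?thesis ..
    next
      case 3
      define t where "t = (u - a x) / (1 + 2 * a x)"
      have "t \<le> 0" "- 1/2 \<le> t"
        using 3 ax by (auto simp: t_def field_simps)
      moreover have "t * (1 + 2 * a x) = u - a x"
        using ax by (simp add: t_def)
      ultimately have "lift a (x, t) = (x, u)"
        by (simp add: lift_def algebra_simps)
      then show ?thesis ..
    qed
  qed
  then show ?thesis
    by (metis surj_def surj_pair)
qed

section \<open>Realizing a permutation with finitely many displacements\<close>

text \<open>The map is \<open>inv (lift b) \<circ> H \<circ> lift a\<close> with a shear
  \<open>H\<close>. It carries \<open>(z, 0)\<close> to \<open>(z, h (\<sigma> z - z))\<close>, then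
  to \<open>(\<sigma> z, h (\<sigma> z - z))\<close>, then to \<open>(\<sigma> z, 0)\<close>. The
  upper bound multiplies \<open>3 * K * M\<close>, \<open>C\<close> and \<open>3 * M\<close>; in the
  lower bound the two outer factors exchange their constants, so the product is the same.\<close>

lemma realize_permutation:
  fixes \<sigma> :: "'a::real_normed_vector \<Rightarrow> 'a"
    and M R :: real
  assumes \<sigma>: "bij_betw \<sigma> Z Z" and M: "M \<ge> 1" and R: "R \<ge> 0"
    and sep: "\<And>x y. x \<in> Z \<Longrightarrow> y \<in> Z \<Longrightarrow> x \<noteq> y \<Longrightarrow> 1 / M \<le> dist x y"
    and V: "finite V" "V \<noteq> {}"
    and disp: "\<And>z. z \<in> Z \<Longrightarrow> \<sigma> z - z \<in> V"
    and norm_V: "\<And>v. v \<in> V \<Longrightarrow> norm v \<le> R"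
  obtains \<Upsilon> :: "'a \<times> real \<Rightarrow> 'a \<times> real" where
    "bilipschitz_on (9 * M\<^sup>2 * real (card V) * (1 + 2 * real (card V) * R)) UNIV \<Upsilon>"
    "\<And>x t. \<bar>t\<bar> \<ge> 1/2 \<Longrightarrow> \<Upsilon> (x, t) = (x, t)"
    "\<And>z. z \<in> Z \<Longrightarrow> \<Upsilon> (z, 0) = (\<sigma> z, 0)"
proof -
  define K where "K = real (card V)"
  have K: "K \<ge> 1"
    using V by (simp add: K_def Suc_le_eq card_gt_0_iff)
  obtain e where e: "bij_betw e V {0..<card V}"
    using ex_bij_betw_finite_nat[OF V(1)] by blast
  \<comment> \<open>These are the midpoints of \<open>K\<close> equal subintervals of
    \<open>[- 1/2, 1/2]\<close>: their spacing is \<open>1 / K\<close>, and a margin of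
    \<open>1 / (2 * K)\<close> remains at both ends. The margin is what
    \<open>lift_bilipschitz\<close> asks for, and it lets the shear die out by height
    \<open>1/2\<close>.\<close>
  define h where "h v = (real (e v) + 1/2) / K - 1/2" for v
  have h_bound: "\<bar>h v\<bar> \<le> 1/2 - 1 / (2 * K)" if "v \<in> V" for v
  proof -
    have "e v < card V"
      using e that by (auto simp: bij_betw_def)
    then have "real (e v) + 1 \<le> K"
      unfolding K_def by linarith
    then show ?thesis
      using K by (simp add: h_def abs_le_iff field_simps)
  qed
  have h_sep: "1 / K \<le> dist (h v) (h w)" if "v \<in> V" "w \<in> V" "v \<noteq> w" for v w
  proof -
    have "e v \<noteq> e w"
      using e that by (auto simp: bij_betw_def inj_on_def)
    then have "1 \<le> \<bar>real (e v) - real (e w)\<bar>"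
      by linarith
    moreover have "h v - h w = (real (e v) - real (e w)) / K"
      using K by (simp add: h_def field_simps)
    ultimately show ?thesis
      using K by (simp add: dist_real_def divide_right_mono)
  qed
  have inj_h: "inj_on h V"
    by (rule inj_onI) (use h_sep K in force)
  \<comment> \<open>Used twice, for the displacements leaving the points of \<open>Z\<close> and for
    those arriving there. The interpolation constant is \<open>(1 - 1 / K) * M\<close>, hence at
    most \<open>M\<close>.\<close>
  have heights: "\<exists>a. M-lipschitz_on UNIV a \<and> (\<forall>z\<in>Z. a z = h (f z)) \<and> (\<forall>x. \<bar>a x\<bar> \<le> 1/2 - 1 / (2 * K))"
    if f: "\<And>z. z \<in> Z \<Longrightarrow> f z \<in> V" for f :: "'a \<Rightarrow> 'a"
  proof -
    have "0 \<le> 1/2 - 1 / (2 * K)" "0 < 1 / M"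
      using K M by (auto simp: field_simps)
    moreover have "norm (h (f z)) \<le> 1/2 - 1 / (2 * K)" if "z \<in> Z" for z
      using h_bound[OF f[OF that]] by simp
    ultimately obtain a where a: "(2 * (1/2 - 1 / (2 * K)) / (1 / M))-lipschitz_on UNIV a"
      "\<And>z. z \<in> Z \<Longrightarrow> a z = h (f z)" "\<And>x. norm (a x) \<le> 1/2 - 1 / (2 * K)"
      using separated_interpolation[of "1 / M" "1/2 - 1 / (2 * K)" Z "\<lambda>z. h (f z)"] sep by metis
    moreover have "2 * (1/2 - 1 / (2 * K)) / (1 / M) \<le> M"
      using K M by (simp add: field_simps)
    ultimately show ?thesis
      using lipschitz_on_le by (intro exI[of _ a]) auto
  qed
  obtain a where a: "M-lipschitz_on UNIV a" "\<And>z. z \<in> Z \<Longrightarrow> a z = h (\<sigma> z - z)"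
    "\<And>x. \<bar>a x\<bar> \<le> 1/2 - 1 / (2 * K)"
    using heights[of "\<lambda>z. \<sigma> z - z"] disp by metis
  have \<sigma>': "inv_into Z \<sigma> (\<sigma> z) = z" "\<sigma> z \<in> Z" if "z \<in> Z" for z
    using \<sigma> that by (auto simp: bij_betw_def)
  have inv_disp: "w - inv_into Z \<sigma> w \<in> V" if w: "w \<in> Z" for w
  proof -
    obtain z where "z \<in> Z" "w = \<sigma> z"
      using bij_betw_imp_surj_on[OF \<sigma>] w by blast
    then show ?thesis
      using \<sigma>'(1)[of z] disp[of z] by simp
  qed
  \<comment> \<open>After the shear the point stands over \<open>\<sigma> z\<close>, so the lowering
    must read the displacement off the target: \<open>b (\<sigma> z)\<close> equals
    \<open>a z\<close>.\<close>
  obtain b where b: "M-lipschitz_on UNIV b" "\<And>w. w \<in> Z \<Longrightarrow> b w = h (w - inv_into Z \<sigma> w)"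
    "\<And>x. \<bar>b x\<bar> \<le> 1/2 - 1 / (2 * K)"
      using heights[of "\<lambda>w. w - inv_into Z \<sigma> w"] inv_disp by metis
  have b\<sigma>: "b (\<sigma> z) = h (\<sigma> z - z)" if "z \<in> Z" for z
    using b(2) \<sigma>'[OF that] by simp
  \<comment> \<open>The heights form a \<open>1 / K\<close>-separated subset of the line, so the
    same interpolation yields the shear, with Lipschitz constant \<open>2 * K * R\<close>.\<close>
  obtain s where s: "(2 * R / (1 / K))-lipschitz_on UNIV s"
    "\<And>r. r \<in> h ` V \<Longrightarrow> s r = inv_into V h r"
    "\<And>t. (\<And>r. r \<in> h ` V \<Longrightarrow> 1 / K / 2 \<le> dist t r) \<Longrightarrow> s t = 0"
  proof (rule separated_interpolation[of "1 / K" R "h ` V" "inv_into V h"])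
    show "1 / K \<le> dist x y" if "x \<in> h ` V" "y \<in> h ` V" "x \<noteq> y" for x y
      using that h_sep by blast
    show "norm (inv_into V h z) \<le> R" if "z \<in> h ` V" for z
      using that inj_h norm_V by auto
  qed (use K R in auto)
  have s0: "s t = 0" if t: "\<bar>t\<bar> \<ge> 1/2" for t
  proof (rule s(3))
    show "1 / K / 2 \<le> dist t r" if r: "r \<in> h ` V" for r
    proof -
      have "\<bar>r\<bar> \<le> 1/2 - 1 / (2 * K)"
        using h_bound r by auto
      then have "1 / (2 * K) \<le> \<bar>t\<bar> - \<bar>r\<bar>"
        using t by linarith
      then show ?thesis
        using abs_triangle_ineq2[of t r] by (simp add: dist_real_def mult.commute)
    qed
  qed
  define C where "C = 1 + 2 * K * R"
  have s_lip: "dist (s t) (s u) \<le> (C - 1) * dist t u" for t u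
    using lipschitz_onD[OF s(1), of t u] K by (simp add: C_def mult_ac)
  have C: "C \<ge> 1"
    using K R by (simp add: C_def)
  define H where "H p = (fst p + s (snd p), snd p)" for p
  \<comment> \<open>The offsets are left free so that one estimate serves for \<open>H\<close> and,
    with the signs of \<open>s\<close> reversed, for its inverse.\<close>
  have shear: "dist (fst p + r, snd p) (fst q + r', snd q) \<le> C * dist p q"
    if "dist r r' \<le> (C - 1) * dist (snd p) (snd q)" for p q :: "'a \<times> real" and r r'
  proof -
    have "dist (fst p + r, snd p) (fst q + r', snd q) = norm ((p - q) + (r - r', 0))"
      by (simp add: dist_norm minus_prod_def algebra_simps)
    also have "\<dots> \<le> norm (p - q) + norm (r - r')"
      by (metis norm_triangle_ineq norm_Pair2 norm_Pair1)
    also have "\<dots> \<le> dist p q + (C - 1) * dist p q"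
      using that C dist_snd_le[of p q] mult_left_mono[of "dist (snd p) (snd q)" "dist p q" "C - 1"]
      by (simp add: dist_norm)
    finally show ?thesis
      by (simp add: algebra_simps)
  qed
  have H: "dist (H p) (H q) \<le> C * dist p q" for p q
    using shear[OF s_lip] by (simp add: H_def)
  have H': "dist p q \<le> C * dist (H p) (H q)" for p q
    using shear[of "- s (snd p)" "- s (snd q)" "H p" "H q"] s_lip[of "snd p" "snd q"]
    by (simp add: H_def dist_minus)
  define W where "W = inv (lift b)"
  have "1/2 - 1 / (2 * K) < 1/2"
    using K by simp
  then have surj_b: "surj (lift b)"
    by (intro surj_lift) (meson b(3) le_less_trans)
  have lift_W: "lift b (W p) = p" for p
    using surj_b by (simp add: W_def surj_f_inv_f)
  have W: "dist (W p) (W q) \<le> 3 * K * M * dist p q" "dist p q \<le> 3 * M * dist (W p) (W q)" for p q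
    using lift_bilipschitz[OF K M b(1,3), where p = "W p" and q = "W q"] by (simp_all add: lift_W)
  \<comment> \<open>Preimages under \<open>lift b\<close> are unique by its lower estimate, applied
    where the images coincide.\<close>
  have W_eq: "W p = q" if "lift b q = p" for p q
    using W(1)[of p p] lift_bilipschitz(2)[OF K M b(1,3), where p = "W p" and q = q] that
    by (simp add: lift_W)
  define \<Upsilon> where "\<Upsilon> = W \<circ> H \<circ> lift a"
  have const: "9 * M\<^sup>2 * real (card V) * (1 + 2 * real (card V) * R) = 3 * K * M * (C * (3 * M))"
    by (simp add: C_def K_def power2_eq_square)
  show thesis
  proof (rule that[of \<Upsilon>])
    show "bilipschitz_on (9 * M\<^sup>2 * real (card V) * (1 + 2 * real (card V) * R)) UNIV \<Upsilon>"
      unfolding const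
    proof (rule bilipschitz_onI)
      show "0 \<le> 3 * K * M * (C * (3 * M))"
        using K M C by simp
      fix p q :: "'a \<times> real"
      have "dist (\<Upsilon> p) (\<Upsilon> q) \<le> 3 * K * M * dist (H (lift a p)) (H (lift a q))"
        unfolding \<Upsilon>_def o_def by (rule W)
      also have "\<dots> \<le> 3 * K * M * (C * dist (lift a p) (lift a q))"
        using K M by (intro mult_left_mono H) auto
      also have "\<dots> \<le> 3 * K * M * (C * (3 * M * dist p q))"
        using K M C by (intro mult_left_mono lift_bilipschitz[OF K M a(1,3)]) auto
      finally show "dist (\<Upsilon> p) (\<Upsilon> q) \<le> 3 * K * M * (C * (3 * M)) * dist p q"
        by (simp add: mult_ac)
      have "dist p q \<le> 3 * K * M * dist (lift a p) (lift a q)"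
        by (rule lift_bilipschitz[OF K M a(1,3)])
      also have "\<dots> \<le> 3 * K * M * (C * dist (H (lift a p)) (H (lift a q)))"
        using K M by (intro mult_left_mono H') auto
      also have "\<dots> \<le> 3 * K * M * (C * (3 * M * dist (\<Upsilon> p) (\<Upsilon> q)))"
        unfolding \<Upsilon>_def o_def using K M C by (intro mult_left_mono W) auto
      finally show "dist p q \<le> 3 * K * M * (C * (3 * M)) * dist (\<Upsilon> p) (\<Upsilon> q)"
        by (simp add: mult_ac)
    qed
    show "\<Upsilon> (x, t) = (x, t)" if "\<bar>t\<bar> \<ge> 1/2" for x t
      unfolding \<Upsilon>_def o_def using that by (intro W_eq) (simp add: lift_def H_def s0)
    show "\<Upsilon> (z, 0) = (\<sigma> z, 0)" if z: "z \<in> Z" for z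
    proof -
      have "s (h (\<sigma> z - z)) = \<sigma> z - z"
        using s(2) disp[OF z] inj_h by simp
      then show ?thesis
        unfolding \<Upsilon>_def o_def by (intro W_eq) (simp add: lift_def H_def a(2)[OF z] b\<sigma>[OF z])
    qed
  qed
qed

section \<open>Permutations of scaled lattices\<close>

text \<open>Counts the candidates for displacements: multiplication by \<open>N\<close> turns them
  into integer vectors with entries between \<open>- M\<close> and \<open>M\<close>.\<close>

lemma card_bounded_scaled_lattice:
  fixes N M :: nat
  assumes "N \<ge> 1"
  defines "V \<equiv> {v \<in> scaled_lattice N. \<forall>i. \<bar>real N * v $ i\<bar> \<le> real M} :: (real^'n) set"
  shows "finite V" and "card V \<le> (2 * M + 1) ^ CARD('n)"
proof -
  define F where "F = (UNIV :: 'n set) \<rightarrow>\<^sub>E {- int M..int M}"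
  define g where "g f = (\<chi> i. real_of_int (f i) / real N :: real^'n)" for f :: "'n \<Rightarrow> int"
  have fin: "finite F"
    by (auto simp: F_def intro: finite_PiE)
  have card_F: "card F = (2 * M + 1) ^ CARD('n)"
    by (simp add: F_def card_PiE nat_add_distrib nat_mult_distrib flip: mult_2)
  have V: "V \<subseteq> g ` F"
  proof
    fix v assume v: "v \<in> V"
    then have "\<forall>i. \<exists>k. real N * v $ i = real_of_int k"
      by (auto simp: V_def scaled_lattice_def Ints_def)
    then obtain f where f: "\<And>i. real N * v $ i = real_of_int (f i)"
      by metis
    have "\<bar>real_of_int (f i)\<bar> \<le> real M" for i
      using v unfolding f[symmetric] by (simp add: V_def)
    then have "\<bar>f i\<bar> \<le> int M" for i
      by (metis of_int_abs of_int_le_iff of_int_of_nat_eq)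
    then have "f \<in> F"
      by (auto simp: F_def abs_le_iff) (smt (verit))+
    moreover have "v = g f"
      using \<open>N \<ge> 1\<close> by (simp add: vec_eq_iff g_def flip: f)
    ultimately show "v \<in> g ` F"
      by blast
  qed
  show "finite V"
    using V fin finite_surj by blast
  show "card V \<le> (2 * M + 1) ^ CARD('n)"
    using surj_card_le[OF fin V] card_F by simp
qed

lemma scaled_lattice_diff:
  "x \<in> scaled_lattice N \<Longrightarrow> y \<in> scaled_lattice N \<Longrightarrow> x - y \<in> scaled_lattice N"
  by (simp add: scaled_lattice_def right_diff_distrib)

text \<open>Some coordinate differs, and there \<open>N\<close> times the difference is a nonzero
  integer.\<close>

lemma scaled_lattice_separated:
  fixes x y :: "real^'n"
  assumes N: "N \<ge> 1" and xy: "x \<in> scaled_lattice N" "y \<in> scaled_lattice N" "x \<noteq> y"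
  shows "1 / real N \<le> dist x y"
proof -
  obtain i where i: "x $ i \<noteq> y $ i"
    using xy(3) by (auto simp: vec_eq_iff)
  obtain k l where kl: "real N * x $ i = of_int k" "real N * y $ i = of_int l"
    using xy(1,2) by (auto simp: scaled_lattice_def elim!: Ints_cases dest!: spec[of _ i])
  have eq: "real N * (x $ i - y $ i) = of_int (k - l)"
    using kl by (simp add: right_diff_distrib)
  with i N have "k - l \<noteq> 0"
    by auto
  then have "1 \<le> \<bar>real_of_int (k - l)\<bar>"
    by linarith
  also have "\<dots> = real N * \<bar>x $ i - y $ i\<bar>"
    unfolding eq[symmetric] by (simp add: abs_mult)
  also have "\<dots> \<le> real N * dist x y"
    using component_le_norm_cart[of "x - y" i] by (intro mult_left_mono) (auto simp: dist_norm)
  finally show ?thesis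
    using N by (simp add: field_simps)
qed

text \<open>\<open>M\<close> bounds coordinates in units of \<open>1 / N\<close> and controls the
  number of displacements; \<open>R\<close> bounds their length. They are kept apart because for
  block permutations the norm bound comes from the coordinates, and for bounded displacement the
  coordinate bound comes from the norm. The count enters squared, hence the exponent
  \<open>2 * CARD('n)\<close>.\<close>

lemma realize_lattice_permutation:
  fixes \<sigma> :: "real^'n \<Rightarrow> real^'n" and N M :: nat and R :: real
  assumes N: "N \<ge> 1" and \<sigma>: "bij_betw \<sigma> (scaled_lattice N) (scaled_lattice N)"
    and coord: "\<And>z i. z \<in> scaled_lattice N \<Longrightarrow> \<bar>real N * (\<sigma> z - z) $ i\<bar> \<le> real M"
    and norm: "\<And>z. z \<in> scaled_lattice N \<Longrightarrow> norm (\<sigma> z - z) \<le> R"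
    and R: "1 \<le> R"
  obtains \<Upsilon> :: "(real^'n) \<times> real \<Rightarrow> (real^'n) \<times> real" where
    "bilipschitz_on (27 * (real N)\<^sup>2 * R * real (2 * M + 1) ^ (2 * CARD('n))) UNIV \<Upsilon>"
    "\<And>x t. \<bar>t\<bar> \<ge> 1/2 \<Longrightarrow> \<Upsilon> (x, t) = (x, t)"
    "\<And>z. z \<in> scaled_lattice N \<Longrightarrow> \<Upsilon> (z, 0) = (\<sigma> z, 0)"
proof -
  let ?Z = "scaled_lattice N :: (real^'n) set"
  define V where "V = (\<lambda>z. \<sigma> z - z) ` ?Z"
  have "V \<subseteq> {v \<in> ?Z. \<forall>i. \<bar>real N * v $ i\<bar> \<le> real M}"
    using \<sigma> coord by (auto simp: V_def bij_betw_def intro!: scaled_lattice_diff)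
  then have V: "finite V" "card V \<le> (2 * M + 1) ^ CARD('n)"
    using card_bounded_scaled_lattice[OF N, of M, where 'n = 'n]
    by (auto intro: finite_subset order_trans[OF card_mono])
  have "0 \<in> ?Z"
    by (simp add: scaled_lattice_def)
  then have "V \<noteq> {}"
    by (auto simp: V_def)
  obtain \<Upsilon> :: "(real^'n) \<times> real \<Rightarrow> (real^'n) \<times> real"
    where \<Upsilon>: "bilipschitz_on (9 * (real N)\<^sup>2 * real (card V) * (1 + 2 * real (card V) * R)) UNIV \<Upsilon>"
    "\<And>x t. \<bar>t\<bar> \<ge> 1/2 \<Longrightarrow> \<Upsilon> (x, t) = (x, t)"
    "\<And>z. z \<in> ?Z \<Longrightarrow> \<Upsilon> (z, 0) = (\<sigma> z, 0)"
  proof (rule realize_permutation[OF \<sigma>, of "real N" R V])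
    show "1 / real N \<le> dist x y" if "x \<in> ?Z" "y \<in> ?Z" "x \<noteq> y" for x y
      using scaled_lattice_separated[OF N that] .
  qed (use N R V \<open>V \<noteq> {}\<close> norm in \<open>auto simp: V_def\<close>)
  define k where "k = real (card V)"
  have k: "1 \<le> k"
    using V(1) \<open>V \<noteq> {}\<close> by (simp add: k_def Suc_le_eq card_gt_0_iff)
  have "k \<le> real (2 * M + 1) ^ CARD('n)"
    using V(2) unfolding k_def by (metis of_nat_le_iff of_nat_power)
  then have k_sq: "k\<^sup>2 \<le> real (2 * M + 1) ^ (2 * CARD('n))"
    using k by (subst mult.commute) (simp add: power_mult power_mono)
  \<comment> \<open>This gives \<open>1 + 2 * k * R \<le> 3 * (k * R)\<close> and turns the factor 9
    into 27.\<close>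
  have "1 * 1 \<le> k * R"
    using k R by (intro mult_mono) auto
  then have "9 * (real N)\<^sup>2 * k * (1 + 2 * k * R) \<le> 9 * (real N)\<^sup>2 * k * (3 * (k * R))"
    using k by (intro mult_left_mono) (auto simp: mult.commute)
  also have "\<dots> = 27 * (real N)\<^sup>2 * R * k\<^sup>2"
    by (simp add: power2_eq_square)
  also have "\<dots> \<le> 27 * (real N)\<^sup>2 * R * real (2 * M + 1) ^ (2 * CARD('n))"
    using k_sq R by (intro mult_left_mono) auto
  finally show thesis
    by (intro that[OF bilipschitz_on_mono[OF \<Upsilon>(1)[folded k_def]]] \<Upsilon>(2,3))
qed

section \<open>Reversing the blocks of the integer lattice\<close>

text \<open>In each coordinate a block with index \<open>q\<close> contains the integers from
  \<open>S * q\<close> to \<open>S * q + S - 1\<close>, and a lattice point goes to the sum of these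
  ends minus itself. Reading the index off by a floor lets one formula cover all blocks.\<close>

definition block_reversal :: "nat \<Rightarrow> real^'n \<Rightarrow> real^'n" where
  "block_reversal S x = (\<chi> i. 2 * real S * of_int \<lfloor>x $ i / real S\<rfloor> + real S - 1 - x $ i)"

lemma floor_divide_in_block:
  fixes z :: "real^'n"
  assumes S: "S \<ge> 1" and z: "z \<in> scaled_lattice 1"
    and x: "x \<in> scaled_lattice 1" "x \<in> cube_block S z"
  shows "real_of_int \<lfloor>x $ i / real S\<rfloor> = z $ i"
proof -
  obtain k l where kl: "x $ i = real_of_int k" "z $ i = real_of_int l"
    using z x(1) by (auto simp: scaled_lattice_def elim!: Ints_cases dest!: spec[of _ i])
  have "- 1/2 + real S * z $ i \<le> x $ i" "x $ i \<le> - 1/2 + real S * z $ i + real S"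
    using x(2) by (auto simp: cube_block_def)
  then have "real_of_int (int S * l) \<le> k + 1/2" "real_of_int (int S * l + int S) \<ge> k + 1/2"
    by (simp_all add: kl)
  \<comment> \<open>Integrality sharpens the half-integer bounds, so \<open>k\<close> runs from
    \<open>S * l\<close> to \<open>S * l + S - 1\<close> and adjacent closed cubes share no lattice
    point.\<close>
  then have "int S * l \<le> k" "k + 1 \<le> int S * l + int S"
    by linarith+
  then have "real_of_int (int S * l) \<le> k" "real_of_int (k + 1) \<le> real_of_int (int S * l + int S)"
    by (simp_all only: of_int_le_iff)
  then have "\<lfloor>x $ i / real S\<rfloor> = l"
    using S by (simp add: floor_eq_iff kl field_simps)
  then show ?thesis
    by (simp add: kl)
qed

lemma mem_own_block:
  fixes x :: "real^'n"
  assumes S: "S \<ge> 1" and x: "x \<in> scaled_lattice 1"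
  shows "\<exists>z\<in>scaled_lattice 1. x \<in> cube_block S z"
proof
  let ?z = "(\<chi> i. of_int \<lfloor>x $ i / real S\<rfloor>) :: real^'n"
  show "?z \<in> scaled_lattice 1"
    by (simp add: scaled_lattice_def)
  have "real S * of_int \<lfloor>x $ i / real S\<rfloor> \<le> x $ i \<and>
      x $ i \<le> - 1/2 + real S * of_int \<lfloor>x $ i / real S\<rfloor> + real S" for i
  proof -
    let ?q = "\<lfloor>x $ i / real S\<rfloor>"
    obtain k where k: "x $ i = real_of_int k"
      using x by (auto simp: scaled_lattice_def elim!: Ints_cases dest!: spec[of _ i])
    have "real S * of_int ?q \<le> real S * (x $ i / real S)"
      by (intro mult_left_mono) auto
    then have le: "real S * of_int ?q \<le> x $ i"
      using S by simp
    have "real S * (x $ i / real S) < real S * (of_int ?q + 1)"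
      using S by (intro mult_strict_left_mono) auto
    then have "x $ i < real S * of_int ?q + real S"
      using S by (simp add: distrib_left)
    then have "real_of_int k < real_of_int (int S * ?q + int S)"
      by (simp add: k)
    \<comment> \<open>Integrality improves the strict bound by 1, which leaves room for the offset
      \<open>1/2\<close>.\<close>
    then have "k + 1 \<le> int S * ?q + int S"
      by linarith
    then have "real_of_int (k + 1) \<le> real_of_int (int S * ?q + int S)"
      by (simp only: of_int_le_iff)
    with le show ?thesis
      by (simp add: k)
  qed
  note bounds = this
  have "- 1/2 + real S * ?z $ i \<le> x $ i \<and> x $ i \<le> - 1/2 + real S * ?z $ i + real S" for i
    unfolding vec_lambda_beta using bounds[of i] by linarith
  then show "x \<in> cube_block S ?z"
    unfolding cube_block_def mem_Collect_eq by (rule allI)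
qed

lemma block_reversal_lattice: "block_reversal S x \<in> scaled_lattice 1" if "x \<in> scaled_lattice 1"
  using that by (simp add: scaled_lattice_def block_reversal_def)

text \<open>The reflected point stays in the block, so its floor gives the same index and the second
  reflection undoes the first.\<close>

lemma block_reversal_block:
  assumes S: "S \<ge> 1" and z: "z \<in> scaled_lattice 1"
    and x: "x \<in> scaled_lattice 1" "x \<in> cube_block S z"
  shows "block_reversal S x \<in> cube_block S z"
    and "block_reversal S (block_reversal S x) = x"
proof -
  show in_block: "block_reversal S x \<in> cube_block S z"
    unfolding cube_block_def
  proof (intro CollectI allI)
    fix i
    have "- 1/2 + real S * z $ i \<le> x $ i \<and> x $ i \<le> - 1/2 + real S * z $ i + real S"
      using x(2) by (simp add: cube_block_def)
    moreover have "block_reversal S x $ i = 2 * (real S * z $ i) + real S - 1 - x $ i"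
      using floor_divide_in_block[OF S z x] by (simp add: block_reversal_def)
    ultimately show "- 1/2 + real S * z $ i \<le> block_reversal S x $ i \<and>
        block_reversal S x $ i \<le> - 1/2 + real S * z $ i + real S"
      by linarith
  qed
  show "block_reversal S (block_reversal S x) = x"
    using floor_divide_in_block[OF S z x]
      floor_divide_in_block[OF S z block_reversal_lattice[OF x(1)] in_block]
    by (simp add: vec_eq_iff) (simp add: block_reversal_def)
qed

lemma bij_betw_block_reversal:
  fixes z :: "real^'n"
  assumes "S \<ge> 1"
  shows "bij_betw (block_reversal S) (scaled_lattice 1) (scaled_lattice 1 :: (real^'n) set)"
    and "z \<in> scaled_lattice 1 \<Longrightarrow>
      bij_betw (block_reversal S) (scaled_lattice 1 \<inter> cube_block S z) (scaled_lattice 1 \<inter> cube_block S z)"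
proof -
  have involution: "bij_betw (block_reversal S) A A"
    if "\<And>x. x \<in> A \<Longrightarrow> block_reversal S x \<in> A" "\<And>x. x \<in> A \<Longrightarrow> block_reversal S (block_reversal S x) = x"
    for A :: "(real^'n) set"
    using that by (intro bij_betwI[where g = "block_reversal S"]) auto
  show "bij_betw (block_reversal S) (scaled_lattice 1) (scaled_lattice 1 :: (real^'n) set)"
  proof (rule involution)
    show "block_reversal S (block_reversal S x) = x" if x: "x \<in> scaled_lattice 1" for x :: "real^'n"
      using mem_own_block[OF assms x] block_reversal_block(2)[OF assms _ x] by blast
  qed (rule block_reversal_lattice)
  show "bij_betw (block_reversal S) (scaled_lattice 1 \<inter> cube_block S z) (scaled_lattice 1 \<inter> cube_block S z)"
    if z: "z \<in> scaled_lattice 1"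
  proof (rule involution)
    fix x assume x: "x \<in> scaled_lattice 1 \<inter> cube_block S z"
    show "block_reversal S x \<in> scaled_lattice 1 \<inter> cube_block S z"
      using x block_reversal_lattice block_reversal_block(1)[OF assms z] by blast
    show "block_reversal S (block_reversal S x) = x"
      using x block_reversal_block(2)[OF assms z] by blast
  qed
qed

section \<open>Lower and upper bounds for admissible functions\<close>

lemma admissible_mono:
  assumes "\<psi> \<in> admissible_funs n" "1 \<le> s" "s \<le> t"
  shows "\<psi> s \<le> \<psi> t"
  using assms by (auto simp: admissible_funs_def dest: mono_onD[of _ _ s t])

text \<open>With \<open>S\<close> the integer part of \<open>t\<close>, reversal sends 0 to
  \<open>S - 1\<close> and the neighbour \<open>- c\<close> to \<open>- S\<close> in every
  coordinate. Their distance grows by the factor \<open>2 * S - 1\<close> whatever the dimension,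
  and monotonicity passes from \<open>S\<close> to \<open>t\<close>.\<close>

lemma admissible_ge:
  fixes n :: "'n::finite itself" and t :: real
  assumes \<psi>: "\<psi> \<in> admissible_funs n" and t: "t \<ge> 1"
  shows "2 * real_of_int \<lfloor>t\<rfloor> - 1 \<le> \<psi> t"
proof -
  define S where "S = nat \<lfloor>t\<rfloor>"
  have S: "S \<ge> 1" "real S = real_of_int \<lfloor>t\<rfloor>" "real S \<le> t"
    using t by (auto simp: S_def le_nat_iff le_floor_iff)
  let ?\<sigma> = "block_reversal S :: real^'n \<Rightarrow> real^'n"
  obtain \<Upsilon> :: "(real^'n) \<times> real \<Rightarrow> (real^'n) \<times> real"
    where lip: "bilipschitz_on (\<psi> (real S)) UNIV \<Upsilon>"
    and \<Upsilon>: "\<And>x. x \<in> scaled_lattice 1 \<Longrightarrow> \<Upsilon> (x, 0) = (?\<sigma> x, 0)"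
    using \<psi> S(1) bij_betw_block_reversal[OF S(1), where 'n = 'n]
    unfolding admissible_funs_def mem_Collect_eq by metis
  define c :: "real^'n" where "c = (\<chi> i. 1)"
  have "c \<noteq> 0"
    by (simp add: c_def vec_eq_iff)
  have lattice: "0 \<in> scaled_lattice 1" "- c \<in> scaled_lattice 1"
    by (simp_all add: scaled_lattice_def c_def)
  have "\<lfloor>- 1 / real S\<rfloor> = - 1"
    using S(1) by (simp add: floor_eq_iff field_simps)
  then have "?\<sigma> 0 - ?\<sigma> (- c) = (2 * real S - 1) *\<^sub>R c"
    by (simp add: vec_eq_iff block_reversal_def c_def)
  then have "dist (\<Upsilon> (0, 0)) (\<Upsilon> (- c, 0)) = (2 * real S - 1) * norm c"
    using S(1) by (simp add: \<Upsilon>[OF lattice(1)] \<Upsilon>[OF lattice(2)] dist_Pair_Pair dist_norm)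
  moreover have "dist (0, 0 :: real) (- c, 0) = norm c"
    by (simp add: dist_Pair_Pair dist_norm)
  ultimately have "(2 * real S - 1) * norm c \<le> \<psi> (real S) * norm c"
    using bilipschitz_onD(1)[OF lip, of "(0, 0)" "(- c, 0)"] by simp
  then have "2 * real S - 1 \<le> \<psi> (real S)"
    using \<open>c \<noteq> 0\<close> by simp
  also have "\<dots> \<le> \<psi> t"
    using S(1,3) by (intro admissible_mono[OF \<psi>]) auto
  finally show ?thesis
    by (simp add: S(2))
qed

text \<open>A block permutation moves each coordinate by at most \<open>S\<close>, so the
  realization with \<open>N = 1\<close>, \<open>M = S\<close> and \<open>R = CARD('n) * S\<close>
  applies. Besides the upper bound on \<open>beta\<close>, this shows that the infimum is over a
  nonempty family.\<close>

lemma powr_admissible: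
  fixes n :: "'n::finite itself"
  shows "(\<lambda>t. 2 powr (8 * real (CARD('n) + 1) * t)) \<in> admissible_funs n"
proof -
  let ?n = "CARD('n)"
  let ?\<psi> = "\<lambda>t. 2 powr (8 * real (?n + 1) * t)"
  have "\<exists>\<Upsilon>::(real^'n) \<times> real \<Rightarrow> (real^'n) \<times> real.
      bilipschitz_on (?\<psi> (real S)) UNIV \<Upsilon> \<and>
      (\<forall>x t. \<bar>t\<bar> \<ge> 1/2 \<longrightarrow> \<Upsilon> (x, t) = (x, t)) \<and>
      (\<forall>x\<in>scaled_lattice 1. \<Upsilon> (x, 0) = (\<sigma> x, 0))"
    if S: "S \<ge> 1" and \<sigma>: "bij_betw \<sigma> (scaled_lattice 1) (scaled_lattice 1)"
      and blocks: "\<forall>z\<in>scaled_lattice 1.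
        bij_betw \<sigma> (scaled_lattice 1 \<inter> cube_block S z) (scaled_lattice 1 \<inter> cube_block S z)"
    for S and \<sigma> :: "real^'n \<Rightarrow> real^'n"
  proof -
    have coord: "\<bar>(\<sigma> x - x) $ i\<bar> \<le> real S" if x: "x \<in> scaled_lattice 1" for x i
    proof -
      obtain z where z: "z \<in> scaled_lattice 1" "x \<in> cube_block S z"
        using mem_own_block[OF S x] by blast
      then have "\<sigma> x \<in> cube_block S z"
        using bij_betwE[OF bspec[OF blocks z(1)]] x by blast
      then have "- 1/2 + real S * z $ i \<le> x $ i" "x $ i \<le> - 1/2 + real S * z $ i + real S"
        "- 1/2 + real S * z $ i \<le> \<sigma> x $ i" "\<sigma> x $ i \<le> - 1/2 + real S * z $ i + real S"
        using z(2) by (auto simp: cube_block_def)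
      then show ?thesis
        by (simp add: abs_le_iff)
    qed
    have norm: "norm (\<sigma> x - x) \<le> real ?n * real S" if "x \<in> scaled_lattice 1" for x
    proof -
      have "norm (\<sigma> x - x) \<le> (\<Sum>i\<in>UNIV. \<bar>(\<sigma> x - x) $ i\<bar>)"
        by (rule norm_le_l1_cart)
      also have "\<dots> \<le> (\<Sum>i\<in>(UNIV :: 'n set). real S)"
        by (intro sum_mono coord[OF that])
      finally show ?thesis
        by simp
    qed
    have "1 * 1 \<le> real ?n * real S"
      using S by (intro mult_mono) (auto simp: Suc_le_eq)
    then obtain \<Upsilon> :: "(real^'n) \<times> real \<Rightarrow> (real^'n) \<times> real"
      where \<Upsilon>: "bilipschitz_on (27 * (real 1)\<^sup>2 * (real ?n * real S) * real (2 * S + 1) ^ (2 * ?n)) UNIV \<Upsilon>"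
        "\<And>x t. \<bar>t\<bar> \<ge> 1/2 \<Longrightarrow> \<Upsilon> (x, t) = (x, t)"
        "\<And>z. z \<in> scaled_lattice 1 \<Longrightarrow> \<Upsilon> (z, 0) = (\<sigma> z, 0)"
      using realize_lattice_permutation[OF _ \<sigma>, of S "real ?n * real S"] coord norm
      by (metis mult_1 of_nat_1 order_refl)
    \<comment> \<open>Estimating factor by factor gives the exponent
      \<open>(5 * ?n + 6) * S\<close>, below the allowed \<open>8 * (?n + 1) * S\<close>.\<close>
    have "27 * (real 1)\<^sup>2 * (real ?n * real S) * real (2 * S + 1) ^ (2 * ?n)
        \<le> 2 ^ (5 * S) * (2 ^ (?n * S) * 2 ^ S) * (2 ^ (2 * S)) ^ (2 * ?n)"
    proof (intro mult_mono power_mono)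
      have "(27::real) \<le> (2 ^ 5) ^ 1"
        by simp
      also have "\<dots> \<le> (2 ^ 5) ^ S"
        using S by (intro power_increasing) auto
      finally show "27 * (real 1)\<^sup>2 \<le> 2 ^ (5 * S)"
        by (simp add: power_mult)
      have "real ?n \<le> 2 ^ ?n"
        using of_nat_less_two_power[of ?n, where 'a = real] by simp
      also have "\<dots> \<le> 2 ^ (?n * S)"
        using S by (intro power_increasing) auto
      finally show "real ?n \<le> 2 ^ (?n * S)" .
      show "real S \<le> 2 ^ S"
        using of_nat_less_two_power[of S, where 'a = real] by simp
      have "2 * S + 1 \<le> 2 ^ (2 * S)"
        using Suc_leI[OF less_exp[of "2 * S"]] by simp
      then show "real (2 * S + 1) \<le> 2 ^ (2 * S)"
        by (metis of_nat_le_iff of_nat_numeral of_nat_power)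
    qed auto
    also have "\<dots> = 2 ^ (5 * S + (?n * S + S) + 2 * S * (2 * ?n))"
      by (simp only: power_add power_mult)
    also have "\<dots> \<le> 2 ^ (8 * (?n + 1) * S)"
      by (intro power_increasing) (auto simp: algebra_simps)
    also have "\<dots> = ?\<psi> (real S)"
      by (simp flip: powr_realpow add: algebra_simps)
    finally show ?thesis
      using bilipschitz_on_mono[OF \<Upsilon>(1)] \<Upsilon>(2,3) by blast
  qed
  moreover have "mono_on {1..} ?\<psi>"
    by (intro mono_onI powr_mono mult_left_mono) auto
  moreover have "?\<psi> ` {1..} \<subseteq> {1..}"
    by (auto intro!: ge_one_powr_ge_zero)
  ultimately show ?thesis
    unfolding admissible_funs_def by blast
qed

section \<open>The pointwise infimum and the comparison of constants\<close>

text \<open>Admissible functions have values at least 1, so the infimum is over a set bounded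
  below.\<close>

lemma beta_le:
  assumes "\<psi> \<in> admissible_funs n" "t \<ge> 1"
  shows "beta n t \<le> \<psi> t"
  unfolding beta_def
proof (rule cINF_lower[OF _ assms(1)])
  show "bdd_below ((\<lambda>\<psi>. \<psi> t) ` admissible_funs n)"
    using assms(2) by (intro bdd_belowI[of _ 1]) (auto simp: admissible_funs_def)
qed

lemma le_beta:
  assumes "\<And>\<psi>. \<psi> \<in> admissible_funs n \<Longrightarrow> c \<le> \<psi> t"
  shows "c \<le> beta n t"
  unfolding beta_def using powr_admissible[of n] assms by (intro cINF_greatest) auto

text \<open>With \<open>r = N * T\<close> the left side is
  \<open>N * (27 * (r * (2 * r + 1) ^ (2 * n)))\<close>, of degree \<open>2 * n + 1\<close> in
  \<open>r\<close>, and \<open>b\<close> is at least \<open>11 * r\<close>. The power suffices since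
  \<open>2 * n + 1 \<le> 3 ^ n\<close>, while \<open>27 * 9 ^ n \<le> 11 * 121 ^ n\<close> absorbs
  the constants.\<close>

lemma constant_le_beta_power:
  fixes n N T :: nat and b :: real
  assumes n: "n \<ge> 1" and N: "N \<ge> 1" and T: "T \<ge> 1" and b: "12 * (real N * real T) - 1 \<le> b"
  shows "27 * (real N)\<^sup>2 * real T * real (2 * (N * T) + 1) ^ (2 * n) \<le> real N * b ^ (3 ^ n)"
proof -
  define r where "r = real N * real T"
  have "1 * 1 \<le> r"
    unfolding r_def using N T by (intro mult_mono) auto
  then have r: "1 \<le> r" "11 * r \<le> b"
    using b by (simp_all add: r_def)
  \<comment> \<open>The comparison of the constants fails at \<open>n = 0\<close>; splitting off one
    factor 9 against 121 makes the rest monotone.\<close>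
  obtain k where k: "n = Suc k"
    using n by (cases n) auto
  have "27 * 9 ^ n \<le> 11 * (121 :: real) ^ n"
    unfolding k power_Suc by (simp add: mult_mono power_mono)
  then have "(27 * 9 ^ n) * (r * r ^ (2 * n)) \<le> (11 * 121 ^ n) * (r * r ^ (2 * n))"
    using r(1) by (intro mult_right_mono) auto
  moreover have "(3 * r) ^ (2 * n) = 9 ^ n * r ^ (2 * n)" "(11 * r) ^ (2 * n) = 121 ^ n * r ^ (2 * n)"
    by (simp_all add: power_mult power_mult_distrib)
  ultimately have "27 * (r * (3 * r) ^ (2 * n)) \<le> (11 * r) * (11 * r) ^ (2 * n)"
    by (simp only: mult_ac)
  also have "\<dots> = (11 * r) ^ (2 * n + 1)"
    by simp
  also have "\<dots> \<le> (11 * r) ^ (3 ^ n)"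
  proof -
    have "2 * n + 1 \<le> 3 ^ n"
      by (induction n) auto
    then show ?thesis
      using r(1) by (intro power_increasing) auto
  qed
  also have "\<dots> \<le> b ^ (3 ^ n)"
    using r by (intro power_mono) auto
  finally have main: "27 * (r * (3 * r) ^ (2 * n)) \<le> b ^ (3 ^ n)" .
  have "27 * (real N)\<^sup>2 * real T * real (2 * (N * T) + 1) ^ (2 * n) = real N * (27 * (r * (2 * r + 1) ^ (2 * n)))"
    by (simp add: r_def power2_eq_square mult_ac add_ac)
  also have "\<dots> \<le> real N * (27 * (r * (3 * r) ^ (2 * n)))"
    using r(1) by (intro mult_left_mono power_mono) auto
  also have "\<dots> \<le> real N * b ^ (3 ^ n)"
    using main by (intro mult_left_mono) auto
  finally show ?thesis .
qed

section \<open>Properties of \<open>beta\<close> and the bilipschitz map of a strip\<close>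

theorem theorem5p1:
  fixes n :: "'n::finite itself"
  defines "d \<equiv> CARD('n) + 1"
  shows "mono_on {1..} (beta n)
    \<and> (\<forall>t::real. t \<ge> 1 \<longrightarrow> 2 * real_of_int \<lfloor>t\<rfloor> - 1 \<le> beta n t \<and> beta n t \<le> 2 powr (8 * real d * t))
    \<and> (\<forall>(T::nat) (N::nat) (m::real) (\<sigma>::real^'n \<Rightarrow> real^'n).
          T \<ge> 1 \<longrightarrow> N \<ge> 1 \<longrightarrow>
          bij_betw \<sigma> (scaled_lattice N) (scaled_lattice N) \<longrightarrow>
          (\<forall>x\<in>scaled_lattice N. norm (\<sigma> x - x) \<le> real T) \<longrightarrow>
          (\<exists>\<Upsilon>::(real^'n) \<times> real \<Rightarrow> (real^'n) \<times> real.
             \<Upsilon> ` (UNIV \<times> {m - 1/2 .. m + 1/2}) \<subseteq> UNIV \<times> {m - 1/2 .. m + 1/2} \<and>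
             bilipschitz_on (real N * (beta n (6 * real N * real T)) ^ (3 ^ (d - 1)))
               (UNIV \<times> {m - 1/2 .. m + 1/2}) \<Upsilon> \<and>
             (\<forall>x. \<Upsilon> (x, m - 1/2) = (x, m - 1/2) \<and> \<Upsilon> (x, m + 1/2) = (x, m + 1/2)) \<and>
             (\<forall>x\<in>scaled_lattice N. \<Upsilon> (x, m) = (\<sigma> x, m))))"
proof (intro conjI allI impI)
  show "mono_on {1..} (beta n)"
  proof (rule mono_onI)
    fix s t :: real
    assume st: "s \<in> {1..}" "t \<in> {1..}" "s \<le> t"
    show "beta n s \<le> beta n t"
    proof (rule le_beta)
      fix \<psi> assume \<psi>: "\<psi> \<in> admissible_funs n"
      have "beta n s \<le> \<psi> s"
        using beta_le[OF \<psi>] st by simp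
      also have "\<dots> \<le> \<psi> t"
        using st by (intro admissible_mono[OF \<psi>]) auto
      finally show "beta n s \<le> \<psi> t" .
    qed
  qed
  show lower: "2 * real_of_int \<lfloor>t\<rfloor> - 1 \<le> beta n t" if "t \<ge> 1" for t
    using admissible_ge[OF _ that] by (rule le_beta)
  show "beta n t \<le> 2 powr (8 * real d * t)" if "t \<ge> 1" for t
    using beta_le[OF powr_admissible that] by (simp add: d_def)
  fix T N :: nat and m :: real and \<sigma> :: "real^'n \<Rightarrow> real^'n"
  assume T: "T \<ge> 1" and N: "N \<ge> 1"
    and \<sigma>: "bij_betw \<sigma> (scaled_lattice N) (scaled_lattice N)"
    and disp: "\<forall>x\<in>scaled_lattice N. norm (\<sigma> x - x) \<le> real T"
  let ?strip = "UNIV \<times> {m - 1/2 .. m + 1/2} :: ((real^'n) \<times> real) set"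
  let ?L = "real N * (beta n (6 * real N * real T)) ^ (3 ^ (d - 1))"
  have coord: "\<bar>real N * (\<sigma> z - z) $ i\<bar> \<le> real (N * T)" if "z \<in> scaled_lattice N" for z i
  proof -
    have "\<bar>(\<sigma> z - z) $ i\<bar> \<le> real T"
      using component_le_norm_cart[of "\<sigma> z - z" i] disp that by force
    then show ?thesis
      by (simp add: abs_mult mult_left_mono del: vector_minus_component)
  qed
  have "1 \<le> real T"
    using T by simp
  then obtain \<Upsilon> :: "(real^'n) \<times> real \<Rightarrow> (real^'n) \<times> real"
    where \<Upsilon>: "bilipschitz_on (27 * (real N)\<^sup>2 * real T * real (2 * (N * T) + 1) ^ (2 * CARD('n))) UNIV \<Upsilon>"
      "\<And>x t. \<bar>t\<bar> \<ge> 1/2 \<Longrightarrow> \<Upsilon> (x, t) = (x, t)"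
      "\<And>z. z \<in> scaled_lattice N \<Longrightarrow> \<Upsilon> (z, 0) = (\<sigma> z, 0)"
    using realize_lattice_permutation[OF N \<sigma> coord] disp by metis
  have "1 * 1 \<le> real N * real T"
    using N T by (intro mult_mono) auto
  \<comment> \<open>\<open>6 * N * T\<close> is an integer, so the floor in the lower bound on
    \<open>beta\<close> is exact.\<close>
  then have "12 * (real N * real T) - 1 \<le> beta n (6 * real N * real T)"
    using lower[of "6 * real N * real T"] floor_of_nat[of "6 * N * T", where 'a = real] by simp
  then have lip: "bilipschitz_on ?L UNIV \<Upsilon>"
    using bilipschitz_on_mono[OF \<Upsilon>(1) constant_le_beta_power[OF _ N T]]
    by (simp add: d_def Suc_le_eq)
  have L: "0 \<le> ?L"
    using lip by (auto simp: bilipschitz_on_def intro: lipschitz_on_nonneg)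
  \<comment> \<open>An image beyond height \<open>1/2\<close> would be fixed by
    \<open>\<Upsilon>\<close>, so by injectivity it would equal its preimage, which lies in the
    strip.\<close>
  have strip: "\<bar>snd (\<Upsilon> p)\<bar> \<le> 1/2" if "\<bar>snd p\<bar> \<le> 1/2" for p
  proof (rule ccontr)
    assume *: "\<not> \<bar>snd (\<Upsilon> p)\<bar> \<le> 1/2"
    then have "\<Upsilon> (\<Upsilon> p) = \<Upsilon> p"
      using \<Upsilon>(2)[of "snd (\<Upsilon> p)" "fst (\<Upsilon> p)"] by simp
    moreover have "inj \<Upsilon>"
      using lip by (simp add: bilipschitz_on_def)
    ultimately have "\<Upsilon> p = p"
      by (rule injD[rotated])
    with * that show False
      by simp
  qed
  \<comment> \<open>Conjugation by the vertical translation by \<open>m\<close>, an isometry,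
    preserves the bilipschitz constant.\<close>
  define \<Upsilon>' where "\<Upsilon>' p = \<Upsilon> (p - (0, m)) + (0, m)" for p
  have \<Upsilon>'_Pair: "\<Upsilon>' (x, t) = \<Upsilon> (x, t - m) + (0, m)" for x t
    by (simp add: \<Upsilon>'_def)
  have "\<Upsilon>' ` ?strip \<subseteq> ?strip"
  proof (intro image_subsetI)
    fix p assume "p \<in> ?strip"
    then have "\<bar>snd p - m\<bar> \<le> 1/2"
      unfolding mem_Times_iff atLeastAtMost_iff by linarith
    then have "\<bar>snd (\<Upsilon> (p - (0, m)))\<bar> \<le> 1/2"
      by (intro strip) simp
    then show "\<Upsilon>' p \<in> ?strip"
      unfolding \<Upsilon>'_def mem_Times_iff atLeastAtMost_iff snd_add snd_conv by (intro conjI UNIV_I) linarith+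
  qed
  moreover have "bilipschitz_on ?L ?strip \<Upsilon>'"
  proof (rule bilipschitz_onI[OF L])
    fix p q :: "(real^'n) \<times> real"
    have "dist (p - (0, m)) (q - (0, m)) = dist p q"
      by (simp add: dist_norm)
    then show "dist (\<Upsilon>' p) (\<Upsilon>' q) \<le> ?L * dist p q" "dist p q \<le> ?L * dist (\<Upsilon>' p) (\<Upsilon>' q)"
      using bilipschitz_onD[OF lip, of "p - (0, m)" "q - (0, m)"] by (simp_all add: \<Upsilon>'_def)
  qed
  moreover have "\<forall>x. \<Upsilon>' (x, m - 1/2) = (x, m - 1/2) \<and> \<Upsilon>' (x, m + 1/2) = (x, m + 1/2)"
    by (simp add: \<Upsilon>'_Pair \<Upsilon>(2))
  moreover have "\<forall>x\<in>scaled_lattice N. \<Upsilon>' (x, m) = (\<sigma> x, m)"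
    by (simp add: \<Upsilon>'_Pair \<Upsilon>(3))
  ultimately show "\<exists>\<Upsilon>. \<Upsilon> ` ?strip \<subseteq> ?strip \<and> bilipschitz_on ?L ?strip \<Upsilon> \<and>
      (\<forall>x. \<Upsilon> (x, m - 1/2) = (x, m - 1/2) \<and> \<Upsilon> (x, m + 1/2) = (x, m + 1/2)) \<and>
      (\<forall>x\<in>scaled_lattice N. \<Upsilon> (x, m) = (\<sigma> x, m))"
    by blast
qed

end
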